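(* As $x \to \infty$, $$f(x) < \frac{x}{L(1/6 - o(1), x)}.$$
   Context: For real $c$ and large $x$, $L(c,x) := \exp\left(c\sqrt{\log x \log\log x}\right)$. The arithmetic progression $a \pmod{q}$ is the residue class $\{n \in \mathbb{Z} : n \equiv a \pmod q\}$. A collection $a_1 \pmod{q_1}, \ldots, a_k \pmod{q_k}$ is called disjoint (non-intersecting) if $\{a_i \pmod{q_i}\} \cap \{a_j \pmod{q_j}\} = \emptyset$ whenever $i \neq j$. $f(x)$ denotes the maximum value of $k$ for which there exist integers $2 \leq q_1 < q_2 < \cdots < q_k \leq x$ and integers $a_1, \ldots, a_k$ such that the progressions $a_1 \pmod{q_1}, \ldots, a_k \pmod{q_k}$ are disjoint. The term $o(1)$ denotes a quantity depending on $x$ that tends to $0$ as $x \to \infty$. *)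

theory Defs
  imports Complex_Main "HOL-Number_Theory.Cong" "HOL-Library.Disjoint_Sets"
begin

definition L :: "real \<Rightarrow> real \<Rightarrow> real" where
  "L c x = exp (c * sqrt (ln x * ln (ln x)))"

definition arith_prog :: "int \<Rightarrow> int \<Rightarrow> int set" where
  "arith_prog a q = {n. [n = a] (mod q)}"

text \<open>The moduli and residues are indexed from 0 to \<open>k - 1\<close>.\<close>

definition admissible :: "real \<Rightarrow> nat \<Rightarrow> bool" where
  "admissible x k \<longleftrightarrow>
     (\<exists>q a :: nat \<Rightarrow> int.
        (\<forall>i<k. 2 \<le> q i \<and> real_of_int (q i) \<le> x) \<and>
        strict_mono_on {..<k} q \<and>
        disjoint_family_on (\<lambda>i. arith_prog (a i) (q i)) {..<k})"

definition f :: "real \<Rightarrow> nat" where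
  "f x = Max {k. admissible x k}"

text \<open>The maximum is taken over a finite nonempty set, so it is attained.\<close>

lemma admissible_0: "admissible x 0"
  by (simp add: admissible_def disjoint_family_on_def)

lemma finite_admissible: "finite {k. admissible x k}"
proof (rule finite_subset)
  show "{k. admissible x k} \<subseteq> {..card {2..\<lfloor>x\<rfloor>}}"
  proof
    fix k assume "k \<in> {k. admissible x k}"
    then obtain q :: "nat \<Rightarrow> int"
      where q: "\<forall>i<k. 2 \<le> q i \<and> real_of_int (q i) \<le> x" and m: "strict_mono_on {..<k} q"
      unfolding admissible_def by blast
    have "q ` {..<k} \<subseteq> {2..\<lfloor>x\<rfloor>}"
      using q by (auto simp: le_floor_iff)
    then have "card {..<k} \<le> card {2..\<lfloor>x\<rfloor>}"
      using strict_mono_on_imp_inj_on[OF m] by (intro card_inj_on_le) auto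
    then show "k \<in> {..card {2..\<lfloor>x\<rfloor>}}" by simp
  qed
qed simp

end

(*
  If distinct moduli share a divisor d and their residues agree mod d, disjointness forces their
  cofactors q / d to have a common prime.  So, starting from a family S of moduli up to x with at
  most K prime factors each, one can pass repeatedly to moduli that are all exactly divisible by
  one more prime power p^j, and to one residue class mod p^j: a step costs a factor W * p^j, with
  W a bound for the number of choices of (p, j).  The remaining moduli are multiples of d * p^j,
  hence at most x / (d * p^j) in number, which gives p^j <= x * W^K / |S|.  After at most K steps
  a single modulus is left, so |S| <= (x * W^(K+1) / |S|)^K.  With K about
  (1/2) sqrt (ln x / ln ln x) and W at most a power of ln x this is impossible for
  |S| >= x / (2 L(1/6, x)); and fewer than x / (2 L(1/6, x)) integers up to x have more than K
  prime factors.  The constant 1/6 is not sharp in this argument, so the error term is taken to be 0.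
*)

theory Submission
  imports Defs "HOL-Number_Theory.Number_Theory" "HOL-Analysis.Harmonic_Numbers"
    "HOL-Real_Asymp.Real_Asymp"
begin

section \<open>Pigeonhole by averaging over fibres\<close>

text \<open>The fibres partition \<open>A\<close>, so they cannot all be smaller than the average.
  The bound is multiplied out to avoid division in \<open>nat\<close>.\<close>

lemma ex_large_fibre:
  assumes "finite A" "A \<noteq> {}" "finite B" "g ` A \<subseteq> B"
  shows "\<exists>b\<in>B. card A \<le> card B * card {a \<in> A. g a = b}"
proof (rule ccontr)
  assume "\<not> ?thesis"
  then have less: "card B * card {a \<in> A. g a = b} < card A" if "b \<in> B" for b
    using that by force
  have "B \<noteq> {}"
    using assms by auto
  have "card B * card A = card B * (\<Sum>b\<in>B. card {a \<in> A. g a = b})"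
    using sum.group[OF assms(1,3,4), of "\<lambda>_. 1 :: nat"] by simp
  also have "\<dots> = (\<Sum>b\<in>B. card B * card {a \<in> A. g a = b})"
    by (simp add: sum_distrib_left)
  also have "\<dots> < (\<Sum>b\<in>B. card A)"
    using \<open>B \<noteq> {}\<close> assms less by (intro sum_strict_mono) auto
  finally show False
    by simp
qed

section \<open>Counting integers with many prime factors\<close>

text \<open>Expanding the product of \<open>j + 1\<close> over the primes of \<open>n\<close> gives
  a sum of \<open>j ^ card A\<close> over sets \<open>A\<close> of primes of \<open>n\<close>. These
  sets correspond to the squarefree divisors of \<open>n\<close>; the remaining divisors only
  enlarge the sum.\<close>

lemma Suc_power_card_prime_factors_le:
  fixes n j :: nat
  assumes "n > 0"
  shows "Suc j ^ card (prime_factors n) \<le> (\<Sum>d | d dvd n. j ^ card (prime_factors d))"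
proof -
  \<comment> \<open>A set of primes is recovered from its product, so \<open>Prod\<close> is
    injective on such sets and the sum can be reindexed by divisors.\<close>
  have pf: "prime_factors (\<Prod>A) = A" if "A \<subseteq> prime_factors n" for A
  proof -
    have "finite A"
      using that by (rule finite_subset) simp
    have prime: "prime p" if "p \<in> A" for p
      using \<open>A \<subseteq> prime_factors n\<close> that by (auto simp: in_prime_factors_iff)
    have "0 \<notin> (\<lambda>p. p) ` A"
      using prime by fastforce
    with \<open>finite A\<close> have "prime_factors (\<Prod>A) = (\<Union>p\<in>A. prime_factors p)"
      by (subst prime_factors_prod) (simp_all add: o_def)
    also have "\<dots> = (\<Union>p\<in>A. {p})"
      by (intro SUP_cong refl prime_prime_factors prime)
    also have "\<dots> = A"
      by simp
    finally show ?thesis .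
  qed
  have dvd: "\<Prod>A dvd n" if "A \<subseteq> prime_factors n" for A
  proof -
    have "\<Prod>A dvd \<Prod>(prime_factors n)"
      using that by (intro prod_dvd_prod_subset) auto
    also have "\<dots> dvd (\<Prod>p\<in>prime_factors n. p ^ multiplicity p n)"
      by (intro prod_dvd_prod dvd_power) (auto simp: prime_factors_multiplicity)
    also have "\<dots> = n"
      using assms by (simp flip: prime_factorization_nat)
    finally show ?thesis .
  qed
  have "Suc j ^ card (prime_factors n) = (\<Prod>p\<in>prime_factors n. j + 1)"
    by simp
  also have "\<dots> = (\<Sum>A\<in>Pow (prime_factors n). j ^ card A)"
    by (subst prod_add) auto
  also have "\<dots> = (\<Sum>A\<in>Pow (prime_factors n). j ^ card (prime_factors (\<Prod>A)))"
    by (intro sum.cong) (auto simp: pf)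
  also have "\<dots> = (\<Sum>d\<in>Prod ` Pow (prime_factors n). j ^ card (prime_factors d))"
  proof -
    have "inj_on Prod (Pow (prime_factors n))"
      by (rule inj_on_inverseI[of _ prime_factors]) (simp add: pf)
    then show ?thesis
      by (simp add: sum.reindex)
  qed
  also have "\<dots> \<le> (\<Sum>d | d dvd n. j ^ card (prime_factors d))"
    using assms by (intro sum_mono2) (auto intro: dvd)
  finally show ?thesis .
qed

lemma harm_le_one_plus_ln:
  assumes "n > 0"
  shows "harm n \<le> 1 + ln (real n)"
proof -
  obtain m where "n = Suc m"
    using assms gr0_conv_Suc by blast
  then show ?thesis
    using decseqD[OF decseq_harm_diff_ln, of 0 m] by (simp add: harm_expand)
qed

text \<open>By induction on \<open>j\<close>: the divisor sum above, with \<open>n = d * m\<close>,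
  is dominated by the product of the sum for \<open>j\<close> and a harmonic sum.\<close>

lemma sum_power_card_prime_factors_le:
  "(\<Sum>n=1..N. real j ^ card (prime_factors n) / real n) \<le> harm N ^ j"
proof (induction j)
  case 0
  \<comment> \<open>Since \<open>0 ^ 0 = 1\<close>, exactly the term for \<open>n = 1\<close>, which
    has no prime factor, survives.\<close>
  have "(\<Sum>n=1..N. real 0 ^ card (prime_factors n) / real n) \<le> (\<Sum>n=1..N. if n = 1 then 1 else 0)"
    by (intro sum_mono) (auto simp: prime_factorization_empty_iff power_0_left)
  then show ?case
    by (simp split: if_splits)
next
  case (Suc j)
  have "(\<Sum>n=1..N. real (Suc j) ^ card (prime_factors n) / real n)
      \<le> (\<Sum>n=1..N. \<Sum>d | d dvd n. real j ^ card (prime_factors d) / real n)"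
  proof (intro sum_mono)
    fix n assume "n \<in> {1..N}"
    then have "real (Suc j ^ card (prime_factors n)) \<le> real (\<Sum>d | d dvd n. j ^ card (prime_factors d))"
      by (intro of_nat_mono Suc_power_card_prime_factors_le) auto
    then show "real (Suc j) ^ card (prime_factors n) / real n
        \<le> (\<Sum>d | d dvd n. real j ^ card (prime_factors d) / real n)"
      by (simp add: divide_right_mono flip: sum_divide_distrib)
  qed
  also have "\<dots> = (\<Sum>(n, d)\<in>(SIGMA n:{1..N}. {d. d dvd n}). real j ^ card (prime_factors d) / real n)"
    by (subst sum.Sigma) auto
  also have "\<dots> = (\<Sum>(d, m)\<in>{(d, m). 1 \<le> d * m \<and> d * m \<le> N}. real j ^ card (prime_factors d) / real (d * m))"
    by (rule sum.reindex_bij_witness[of _ "\<lambda>(d, m). (d * m, d)" "\<lambda>(n, d). (d, n div d)"]) (auto elim!: dvdE)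
  \<comment> \<open>Enlarging the region under the hyperbola to the full square makes the double sum
    factor.\<close>
  also have "\<dots> \<le> (\<Sum>(d, m)\<in>{1..N} \<times> {1..N}. real j ^ card (prime_factors d) / real (d * m))"
  proof (intro sum_mono2)
    show "{(d, m). 1 \<le> d * m \<and> d * m \<le> N} \<subseteq> {1..N} \<times> {1..N}"
    proof clarify
      fix d m assume dm: "1 \<le> d * m" "d * m \<le> N"
      then have "d \<ge> 1" "m \<ge> 1"
        by (cases d; cases m; simp)+
      moreover have "d \<le> d * m" "m \<le> d * m"
        using \<open>d \<ge> 1\<close> \<open>m \<ge> 1\<close> by simp_all
      then have "d \<le> N" "m \<le> N"
        using dm(2) by linarith+
      ultimately show "d \<in> {1..N} \<and> m \<in> {1..N}"
        by simp
    qed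
  qed auto
  also have "\<dots> = (\<Sum>d=1..N. real j ^ card (prime_factors d) / real d) * harm N"
    by (simp add: harm_def sum_product sum.cartesian_product divide_inverse mult.assoc)
  also have "\<dots> \<le> harm N ^ j * harm N"
    using Suc by (intro mult_right_mono harm_nonneg)
  finally show ?case
    by (simp add: mult.commute)
qed

text \<open>Rankin's trick: each counted \<open>n\<close> contributes at least
  \<open>j ^ K / x\<close> to the preceding sum. The parameter \<open>j\<close> stays free, to be
  optimised later.\<close>

lemma card_many_prime_factors_le:
  fixes x :: real
  assumes "x \<ge> 1" "j > 0"
  shows "real (card {n. 1 \<le> n \<and> real n \<le> x \<and> K \<le> card (prime_factors n)})
    \<le> x * (1 + ln x) ^ j / real j ^ K"
proof -
  define N where "N = nat \<lfloor>x\<rfloor>"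
  have N: "real N \<le> x" "N > 0"
    using assms by (auto simp: N_def)
  define B where "B = {n. 1 \<le> n \<and> real n \<le> x \<and> K \<le> card (prime_factors n)}"
  have B: "B \<subseteq> {1..N}"
    by (auto simp: B_def N_def le_nat_floor)
  have "real (card B) * (real j ^ K / x) = (\<Sum>n\<in>B. real j ^ K / x)"
    by simp
  also have "\<dots> \<le> (\<Sum>n\<in>B. real j ^ card (prime_factors n) / real n)"
    using assms by (intro sum_mono frac_le power_increasing) (auto simp: B_def)
  also have "\<dots> \<le> (\<Sum>n=1..N. real j ^ card (prime_factors n) / real n)"
    using B by (intro sum_mono2) auto
  also have "\<dots> \<le> harm N ^ j"
    by (rule sum_power_card_prime_factors_le)
  also have "\<dots> \<le> (1 + ln x) ^ j"
  proof (intro power_mono harm_nonneg)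
    have "ln (real N) \<le> ln x"
      using N by simp
    with harm_le_one_plus_ln[OF N(2)] show "harm N \<le> 1 + ln x"
      by simp
  qed
  finally have "real (card B) \<le> (1 + ln x) ^ j / (real j ^ K / x)"
    using assms by (subst pos_le_divide_eq) auto
  then show ?thesis
    by (simp add: B_def mult.commute)
qed

section \<open>The chain of common divisors\<close>

lemma card_multiples_le:
  fixes x :: real
  assumes "x \<ge> 0" "d > 0" "\<And>q. q \<in> A \<Longrightarrow> q > 0 \<and> real q \<le> x \<and> d dvd q"
  shows "real (card A) \<le> x / real d"
proof -
  have "A \<subseteq> (\<lambda>m. d * m) ` {1..nat \<lfloor>x / real d\<rfloor>}"
  proof
    fix q assume "q \<in> A"
    then obtain m where m: "q = d * m"
      using assms(3) by blast
    with assms(3)[OF \<open>q \<in> A\<close>] assms(2) have "m \<ge> 1" "real m \<le> x / real d"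
      by (auto simp: field_simps)
    then show "q \<in> (\<lambda>m. d * m) ` {1..nat \<lfloor>x / real d\<rfloor>}"
      using m by (auto simp: le_nat_floor)
  qed
  then have "card A \<le> card {1..nat \<lfloor>x / real d\<rfloor>}"
    by (rule surj_card_le[rotated]) simp
  then have "real (card A) \<le> real (nat \<lfloor>x / real d\<rfloor>)"
    by simp
  also have "\<dots> \<le> x / real d"
    using assms(1) by (intro of_nat_floor) simp
  finally show ?thesis .
qed

text \<open>The invariant after \<open>r\<close> steps. The divisor \<open>d\<close> is a product of
  \<open>r\<close> prime powers, each at most \<open>Y\<close> and each dividing every modulus in
  \<open>A\<close> exactly. The last conjunct records the loss so far: a factor \<open>d\<close> for
  fixing residues and \<open>W\<close> per step for choosing a prime and its exponent.\<close>

definition chain_state ::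
  "(nat \<Rightarrow> int) \<Rightarrow> nat set \<Rightarrow> nat \<Rightarrow> real \<Rightarrow> nat \<Rightarrow> nat \<Rightarrow> nat set \<Rightarrow> bool"
  where "chain_state a S W Y r d A \<longleftrightarrow>
    A \<subseteq> S \<and> A \<noteq> {} \<and> d > 0 \<and> card (prime_factors d) = r \<and> real d \<le> Y ^ r \<and>
    (\<forall>q\<in>A. d dvd q \<and> coprime d (q div d)) \<and>
    (\<forall>q\<in>A. \<forall>q'\<in>A. [a q = a q'] (mod int d)) \<and>
    card S \<le> card A * d * W ^ r"

text \<open>Distinct moduli let the residue be a function of the modulus. \<open>incongruent\<close>
  is disjointness as seen by the Chinese remainder theorem, and \<open>J_large\<close> makes
  \<open>J\<close> a bound for all exponents in the factorisations of the moduli.\<close>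

locale disjoint_progressions =
  fixes a :: "nat \<Rightarrow> int" and S :: "nat set" and x :: real and K J :: nat
  assumes finite_S: "finite S" and S_nonempty: "S \<noteq> {}"
    and S_pos: "q \<in> S \<Longrightarrow> q > 0"
    and S_le: "q \<in> S \<Longrightarrow> real q \<le> x"
    and few_primes: "q \<in> S \<Longrightarrow> card (prime_factors q) \<le> K"
    and J_large: "x < 2 ^ Suc J"
    and incongruent: "q \<in> S \<Longrightarrow> q' \<in> S \<Longrightarrow> q \<noteq> q' \<Longrightarrow> \<not> [a q = a q'] (mod int (gcd q q'))"
begin

text \<open>The ceiling for the prime power gained in one step; it is derived at \<open>D_le\<close>
  below.\<close>

definition Y :: real
  where "Y = x * real (K * J) ^ K / real (card S)"

lemma card_prime_factors_dvd_le:
  assumes "q \<in> S" "d dvd q"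
  shows "card (prime_factors d) \<le> K"
proof -
  have "card (prime_factors d) \<le> card (prime_factors q)"
    using assms S_pos by (intro card_mono dvd_prime_factors) auto
  with few_primes[OF assms(1)] show ?thesis by simp
qed

lemma x_nonneg: "x \<ge> 0"
  using S_nonempty S_le by (meson equals0I of_nat_0_le_iff order_trans)

lemma multiplicity_le_J:
  assumes "q \<in> S" "prime p"
  shows "multiplicity p q \<le> J"
proof -
  have "2 ^ multiplicity p q \<le> p ^ multiplicity p q"
    using assms prime_ge_2_nat by (intro power_mono) auto
  also have "\<dots> \<le> q"
    using S_pos[OF assms(1)] by (intro dvd_imp_le multiplicity_dvd) auto
  finally have "real (2 ^ multiplicity p q) \<le> real q"
    by (rule of_nat_mono)
  also have "\<dots> < 2 ^ Suc J"
    using S_le[OF assms(1)] J_large by simp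
  finally have "(2::real) ^ multiplicity p q < 2 ^ Suc J"
    by simp
  then have "multiplicity p q < Suc J"
    by (subst (asm) power_strict_increasing_iff) auto
  then show ?thesis by simp
qed

text \<open>
  Two moduli of a state have congruent residues mod \<open>d\<close>, so their cofactors share a prime;
  hence the cofactor of one fixed modulus meets all the others.
\<close>

lemma chain_state_step:
  assumes state: "chain_state a S (K * J) Y r d A" and "card A \<ge> 2"
  shows "\<exists>d' A'. chain_state a S (K * J) Y (Suc r) d' A'"
proof -
  from state have A: "A \<subseteq> S" "d > 0" "card (prime_factors d) = r" "real d \<le> Y ^ r"
    and div: "\<And>q. q \<in> A \<Longrightarrow> d dvd q" "\<And>q. q \<in> A \<Longrightarrow> coprime d (q div d)"
    and cong: "\<And>q q'. q \<in> A \<Longrightarrow> q' \<in> A \<Longrightarrow> [a q = a q'] (mod int d)"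
    and card_S: "card S \<le> card A * d * (K * J) ^ r"
    unfolding chain_state_def by blast+
  have "finite A"
    using A(1) finite_S by (rule finite_subset)
  have common: "\<exists>p. prime p \<and> p dvd q div d \<and> p dvd q' div d"
    if "q \<in> A" "q' \<in> A" "q \<noteq> q'" for q q'
  proof (rule ccontr)
    assume "\<not> ?thesis"
    \<comment> \<open>Coprime cofactors would make \<open>gcd q q'\<close> equal to
      \<open>d\<close>, modulo which the residues agree, against \<open>incongruent\<close>.\<close>
    then have "gcd (q div d) (q' div d) = 1"
      using prime_factor_nat[of "gcd (q div d) (q' div d)"] by (meson gcd_greatest_iff)
    then have "gcd (d * (q div d)) (d * (q' div d)) = d"
      using gcd_mult_distrib_nat[of d "q div d" "q' div d"] by simp
    then have "gcd q q' = d"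
      using div(1) that by simp
    then show False
      using incongruent[of q q'] cong[of q q'] that A(1) by auto
  qed
  have cofactor_dvd: "q div d dvd q" if "q \<in> A" for q
    using div(1)[OF that] by (metis dvd_mult_div_cancel dvd_triv_right)
  obtain q0 q1 where q01: "q0 \<in> A" "q1 \<in> A" "q0 \<noteq> q1"
    using \<open>card A \<ge> 2\<close> by (metis card_2_iff' ex_card order.refl subsetD obtain_subset_with_card_n)
  define P where "P = prime_factors (q0 div d)"
  have "q0 div d \<noteq> 0"
    using q01 A(1,2) S_pos div(1) by (metis dvd_div_eq_0_iff less_irrefl subsetD)
  have "\<exists>p\<in>P. p dvd q div d" if "q \<in> A" for q
  \<comment> \<open>For \<open>q0\<close> itself a prime of the cofactor comes from its partner
    \<open>q1\<close>; this is where two moduli are needed.\<close>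
  proof (cases "q = q0")
    case True
    then show ?thesis
      using common[OF q01] \<open>q0 div d \<noteq> 0\<close> by (auto simp: P_def in_prime_factors_iff)
  next
    case False
    then show ?thesis
      using common[OF that q01(1)] \<open>q0 div d \<noteq> 0\<close> by (auto simp: P_def in_prime_factors_iff)
  qed
  then obtain g where g: "\<And>q. q \<in> A \<Longrightarrow> g q \<in> P \<and> g q dvd q div d"
    by metis
  have P_prime: "prime p" if "p \<in> P" for p
    using that by (simp add: P_def in_prime_factors_iff)

  \<comment> \<open>First pigeonhole: fix both the shared prime and its exact exponent, among at
    most \<open>K * J\<close> pairs.\<close>
  have "(\<lambda>q. (g q, multiplicity (g q) q)) ` A \<subseteq> P \<times> {1..J}"
  proof clarify
    fix q assume q: "q \<in> A"
    have "g q dvd q"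
      using g[OF q] cofactor_dvd[OF q] by (blast intro: dvd_trans)
    then have "multiplicity (g q) q > 0"
      using P_prime g[OF q] S_pos A(1) q by (subst prime_multiplicity_gt_zero_iff) auto
    moreover have "multiplicity (g q) q \<le> J"
      using multiplicity_le_J P_prime g[OF q] A(1) q by blast
    ultimately show "g q \<in> P \<and> multiplicity (g q) q \<in> {1..J}"
      using g[OF q] by simp
  qed
  moreover have "finite (P \<times> {1..J})" "A \<noteq> {}"
    using q01 by (auto simp: P_def)
  ultimately obtain z where z: "z \<in> P \<times> {1..J}"
    "card A \<le> card (P \<times> {1..J}) * card {q \<in> A. (g q, multiplicity (g q) q) = z}"
    using ex_large_fibre[OF \<open>finite A\<close>] by blast
  obtain p j where "z = (p, j)"
    by fastforce
  with z have pj: "p \<in> P" "1 \<le> j" "j \<le> J"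
    and card_le: "card A \<le> card (P \<times> {1..J}) * card {q \<in> A. (g q, multiplicity (g q) q) = (p, j)}"
    by simp_all
  define B where "B = {q \<in> A. (g q, multiplicity (g q) q) = (p, j)}"
  have "prime p"
    using P_prime pj by blast
  define D where "D = d * p ^ j"
  have "card P \<le> K"
    using q01 A(1) cofactor_dvd unfolding P_def
    by (intro card_prime_factors_dvd_le[of q0]) auto
  then have "card (P \<times> {1..J}) \<le> K * J"
    by (simp add: card_cartesian_product)
  then have card_A: "card A \<le> K * J * card B"
    using card_le unfolding B_def by (meson le_trans mult_le_mono1)
  then have "B \<noteq> {}"
    using \<open>card A \<ge> 2\<close> by auto
  have "finite B" "B \<subseteq> A"
    using \<open>finite A\<close> by (auto simp: B_def)

  have p_dvd: "p dvd q div d" and mult_p: "multiplicity p q = j" if "q \<in> B" for q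
    using that g by (auto simp: B_def)
  have "coprime d p"
    using \<open>B \<noteq> {}\<close> \<open>B \<subseteq> A\<close> p_dvd div(2) by (meson coprime_divisors dvd_refl equals0I subsetD)
  then have coprime_d: "coprime d (p ^ j)"
    by simp
  have D_dvd: "D dvd q" and D_coprime: "coprime D (q div D)" if "q \<in> B" for q
  proof -
    have "p ^ j dvd q"
      using mult_p[OF that] multiplicity_dvd by blast
    moreover have "d dvd q"
      using that \<open>B \<subseteq> A\<close> div(1) by blast
    ultimately show "D dvd q"
      unfolding D_def using coprime_d by (simp add: divides_mult)
    have "q > 0"
      using that \<open>B \<subseteq> A\<close> A(1) S_pos by blast
    have q_div_D: "q div D = q div d div p ^ j"
      by (simp add: D_def div_mult2_eq)
    have "coprime d (q div D)"
    proof -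
      have "q div D dvd q div d"
        using \<open>D dvd q\<close> \<open>d > 0\<close> \<open>prime p\<close> unfolding D_def
        by (auto elim!: dvdE simp: prime_gt_0_nat mult.assoc)
      then show ?thesis
        using div(2)[of q] that \<open>B \<subseteq> A\<close> by (meson coprime_divisors dvd_refl subsetD)
    qed
    \<comment> \<open>Exactness of the exponent \<open>j\<close> removes \<open>p\<close> completely
      from the new cofactor.\<close>
    moreover have "coprime (p ^ j) (q div D)"
    proof -
      have "\<not> p dvd q div p ^ j"
        using multiplicity_decompose[of q p] \<open>q > 0\<close> mult_p[OF that] prime_gt_1_nat[OF \<open>prime p\<close>] by auto
      moreover have "q div D dvd q div p ^ j"
        using \<open>D dvd q\<close> \<open>d > 0\<close> \<open>prime p\<close> unfolding D_def
        by (auto elim!: dvdE simp: prime_gt_0_nat mult.assoc mult.left_commute)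
      ultimately have "\<not> p dvd q div D"
        by (meson dvd_trans)
      then show ?thesis
        using \<open>prime p\<close> by (simp add: prime_imp_coprime)
    qed
    ultimately show "coprime D (q div D)"
      by (simp add: D_def)
  qed
  have "D > 0"
    using \<open>d > 0\<close> \<open>prime p\<close> by (simp add: D_def prime_gt_0_nat)
  have card_D: "card (prime_factors D) = Suc r"
  proof -
    have "prime_factors D = insert p (prime_factors d)"
      using \<open>d > 0\<close> \<open>prime p\<close> pj(2) unfolding D_def
      by (subst prime_factors_product) (auto simp: prime_factors_power prime_prime_factors)
    moreover have "p \<notin> prime_factors d"
      using \<open>coprime d p\<close> \<open>prime p\<close> by (metis coprime_common_divisor dvd_refl in_prime_factors_iff not_prime_unit)
    ultimately show ?thesis
      using A(3) by simp
  qed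
  obtain q2 where q2: "q2 \<in> B"
    using \<open>B \<noteq> {}\<close> by blast
  have "Suc r \<le> K"
    using card_prime_factors_dvd_le[of q2 D] D_dvd q2 \<open>B \<subseteq> A\<close> A(1) card_D by auto

  have KJ: "1 \<le> K * J"
    using card_A \<open>card A \<ge> 2\<close> by (cases "K * J") auto
  have card_S': "card S \<le> card B * d * (K * J) ^ Suc r"
  proof -
    have "card S \<le> card A * d * (K * J) ^ r"
      by (rule card_S)
    also have "\<dots> \<le> (K * J * card B) * d * (K * J) ^ r"
      using card_A by (intro mult_le_mono le_refl)
    finally show ?thesis
      by (simp add: mult_ac)
  qed
  \<comment> \<open>\<open>B\<close> consists of multiples of \<open>D\<close> up to
    \<open>x\<close>, so \<open>card B * D\<close> is at most \<open>x\<close>. Multiplying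
    \<open>card_S'\<close> by \<open>p ^ j\<close> then bounds \<open>p ^ j * card S\<close> by
    \<open>x * (K * J) ^ K\<close>, that is, \<open>p ^ j\<close> by \<open>Y\<close>. The gain
    depends on using \<open>B\<close> before a residue class is fixed, as that costs another factor
    \<open>p ^ j\<close>.\<close>
  have D_le: "real D \<le> Y ^ Suc r"
  proof -
    have "real (card B) \<le> x / real D"
      using x_nonneg \<open>D > 0\<close> D_dvd S_pos S_le \<open>B \<subseteq> A\<close> A(1) by (intro card_multiples_le) auto
    then have "real (card B) * real D \<le> x"
      using \<open>D > 0\<close> by (simp add: field_simps)
    have "real (p ^ j) * real (card S) \<le> real (p ^ j) * real (card B * d * (K * J) ^ Suc r)"
      using card_S' by (intro mult_left_mono of_nat_mono) auto
    also have "\<dots> = (real (card B) * real D) * real (K * J) ^ Suc r"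
      by (simp add: D_def mult_ac)
    also have "\<dots> \<le> x * real (K * J) ^ K"
      using KJ \<open>Suc r \<le> K\<close> \<open>real (card B) * real D \<le> x\<close>
        x_nonneg by (intro mult_mono power_increasing) (simp_all del: of_nat_mult)
    finally have "real (p ^ j) \<le> Y"
      using S_nonempty finite_S by (simp add: Y_def field_simps card_gt_0_iff)
    then have "real d * real (p ^ j) \<le> Y ^ r * Y"
      using A(4) by (intro mult_mono) (auto intro: order_trans[OF _ A(4)])
    then show ?thesis
      by (simp add: D_def mult.commute)
  qed

  \<comment> \<open>Second pigeonhole, over residues mod \<open>p ^ j\<close>; its cost turns the
    factor \<open>d\<close> of the size bound into \<open>D\<close>.\<close>
  obtain b where "card B \<le> card {0..<int (p ^ j)} * card {q \<in> B. a q mod int (p ^ j) = b}"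
  proof -
    have "(\<lambda>q. a q mod int (p ^ j)) ` B \<subseteq> {0..<int (p ^ j)}"
      using \<open>prime p\<close> by (auto simp: prime_gt_0_nat)
    then show ?thesis
      using ex_large_fibre[OF \<open>finite B\<close> \<open>B \<noteq> {}\<close>, of "{0..<int (p ^ j)}"] that by auto
  qed
  define C where "C = {q \<in> B. a q mod int (p ^ j) = b}"
  have card_B: "card B \<le> p ^ j * card C"
    using \<open>card B \<le> _\<close> by (simp add: C_def del: of_nat_power)
  then have "C \<noteq> {}"
    using \<open>B \<noteq> {}\<close> \<open>finite B\<close> by auto
  have "C \<subseteq> B"
    by (auto simp: C_def)
  have "[a q = a q'] (mod int D)" if "q \<in> C" "q' \<in> C" for q q'
  proof -
    have "[a q = a q'] (mod int (p ^ j))"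
      using that unfolding C_def Cong.cong_def by simp
    moreover have "[a q = a q'] (mod int d)"
      using that \<open>C \<subseteq> B\<close> \<open>B \<subseteq> A\<close> by (intro cong) auto
    moreover have "coprime (int d) (int (p ^ j))"
      using coprime_d coprime_int_iff by blast
    ultimately show ?thesis
      unfolding D_def of_nat_mult by (intro coprime_cong_mult)
  qed
  moreover have "card S \<le> card C * D * (K * J) ^ Suc r"
  proof -
    have "card S \<le> card B * d * (K * J) ^ Suc r"
      by (rule card_S')
    also have "\<dots> \<le> (p ^ j * card C) * d * (K * J) ^ Suc r"
      using card_B by (intro mult_le_mono le_refl)
    finally show ?thesis
      by (simp add: D_def mult_ac)
  qed
  ultimately have "chain_state a S (K * J) Y (Suc r) D C"
    unfolding chain_state_def
    using \<open>C \<noteq> {}\<close> \<open>C \<subseteq> B\<close> \<open>B \<subseteq> A\<close> A(1) \<open>D > 0\<close> card_D D_le D_dvd D_coprime by blast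
  then show ?thesis by blast
qed

text \<open>If the bound failed, no state could be down to one modulus, since then
  \<open>card S\<close> would be at most \<open>d * (K * J) ^ r\<close>, hence at most
  \<open>(Y * (K * J)) ^ r\<close>. So the step could be repeated until \<open>d\<close> has
  \<open>K + 1\<close> primes, more than any modulus has.\<close>

theorem card_moduli_le:
  assumes "1 \<le> K * J"
  shows "real (card S) \<le> (Y * real (K * J)) ^ K"
proof (rule ccontr)
  assume large: "\<not> ?thesis"
  have "card S > 0"
    using finite_S S_nonempty by (simp add: card_gt_0_iff)
  \<comment> \<open>This yields \<open>1 \<le> Y\<close>, so that the exponent \<open>r\<close> may
    later be raised to \<open>K\<close>.\<close>
  have "real (card S) \<le> x"
    using card_multiples_le[of x 1 S] x_nonneg S_pos S_le by simp
  also have "\<dots> \<le> x * real (K * J) ^ K"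
    using x_nonneg assms mult_left_mono[of 1 "real (K * J) ^ K" x] by (simp add: one_le_power del: of_nat_mult)
  finally have "1 \<le> Y"
    using \<open>card S > 0\<close> by (simp add: Y_def)
  then have YW: "1 \<le> Y * real (K * J)"
    using assms by (metis mult_mono' mult_1 of_nat_mono of_nat_1 zero_le_one)
  have "\<exists>d A. chain_state a S (K * J) Y r d A" for r
  proof (induction r)
    case 0
    have "chain_state a S (K * J) Y 0 1 S"
      using S_nonempty by (simp add: chain_state_def)
    then show ?case by blast
  next
    case (Suc r)
    then obtain d A where state: "chain_state a S (K * J) Y r d A"
      by blast
    then obtain q where q: "q \<in> A" "A \<subseteq> S" "d dvd q" "card (prime_factors d) = r"
      unfolding chain_state_def by blast
    then have "r \<le> K"
      using card_prime_factors_dvd_le by blast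
    have "card A \<ge> 2"
    proof (rule ccontr)
      assume "\<not> card A \<ge> 2"
      have "card S \<le> card A * d * (K * J) ^ r"
        using state by (simp add: chain_state_def)
      also have "\<dots> \<le> 1 * d * (K * J) ^ r"
        using \<open>\<not> card A \<ge> 2\<close> by (intro mult_le_mono le_refl) simp
      finally have "real (card S) \<le> real (1 * d * (K * J) ^ r)"
        by (rule of_nat_mono)
      also have "\<dots> = real d * real (K * J) ^ r"
        by simp
      also have "\<dots> \<le> Y ^ r * real (K * J) ^ r"
        using state by (intro mult_right_mono) (auto simp: chain_state_def)
      also have "\<dots> = (Y * real (K * J)) ^ r"
        by (simp add: power_mult_distrib)
      also have "\<dots> \<le> (Y * real (K * J)) ^ K"
        using YW \<open>r \<le> K\<close> by (rule power_increasing[rotated])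
      finally show False
        using large by simp
    qed
    with state show ?case
      by (rule chain_state_step)
  qed
  then obtain d A where "chain_state a S (K * J) Y (Suc K) d A"
    by blast
  then obtain q where "q \<in> S" "d dvd q" "card (prime_factors d) = Suc K"
    unfolding chain_state_def by blast
  then show False
    using card_prime_factors_dvd_le by fastforce
qed

end

section \<open>From disjoint progressions to incongruent residues\<close>

text \<open>With Bezout coefficients \<open>u\<close>, \<open>v\<close> and
  \<open>b - a = gcd m n * t\<close>, the number \<open>a + u * m * t = b - v * n * t\<close> solves
  both congruences.\<close>

lemma ex_simultaneous_cong:
  fixes a b m n :: int
  assumes "[a = b] (mod gcd m n)"
  shows "\<exists>z. [z = a] (mod m) \<and> [z = b] (mod n)"
proof -
  obtain u v where uv: "u * m + v * n = gcd m n"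
    using bezout_int by blast
  obtain t where t: "b - a = gcd m n * t"
    using assms by (metis cong_iff_dvd_diff cong_sym dvdE)
  have "a + u * m * t - a = m * (u * t)"
    by simp
  moreover have "a + u * m * t - b = n * (- v * t)"
    using t by (simp add: algebra_simps flip: uv)
  ultimately have "[a + u * m * t = a] (mod m)" "[a + u * m * t = b] (mod n)"
    unfolding cong_iff_dvd_diff by (metis dvd_triv_left)+
  then show ?thesis by blast
qed

lemma admissible_f: "admissible x (f x)"
  using Max_in[OF finite_admissible] admissible_0 unfolding f_def by blast

lemma admissible_imp_incongruent_moduli:
  assumes "admissible x k"
  obtains a :: "nat \<Rightarrow> int" and S :: "nat set"
  where "finite S" "card S = k" "\<And>q. q \<in> S \<Longrightarrow> q > 0" "\<And>q. q \<in> S \<Longrightarrow> real q \<le> x"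
    "\<And>q q'. q \<in> S \<Longrightarrow> q' \<in> S \<Longrightarrow> q \<noteq> q' \<Longrightarrow> \<not> [a q = a q'] (mod int (gcd q q'))"
proof -
  obtain q a :: "nat \<Rightarrow> int"
    where q: "\<And>i. i < k \<Longrightarrow> 2 \<le> q i \<and> real_of_int (q i) \<le> x"
      and mono: "strict_mono_on {..<k} q"
      and disj: "disjoint_family_on (\<lambda>i. arith_prog (a i) (q i)) {..<k}"
    using assms unfolding admissible_def by blast
  define Q where "Q = (\<lambda>i. nat (q i))"
  have int_Q: "int (Q i) = q i" if "i < k" for i
    using q[OF that] by (simp add: Q_def)
  have inj: "inj_on Q {..<k}"
  proof (rule inj_onI)
    fix i j assume ij: "i \<in> {..<k}" "j \<in> {..<k}" "Q i = Q j"
    then have "q i = q j"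
      using int_Q[of i] int_Q[of j] by simp
    then show "i = j"
      using ij strict_mono_on_imp_inj_on[OF mono] by (simp add: inj_on_def)
  qed
  \<comment> \<open>The residues reindexed by modulus, using injectivity of
    \<open>Q\<close>.\<close>
  define b where "b = (\<lambda>n. a (the_inv_into {..<k} Q n))"
  have b: "b (Q i) = a i" if "i < k" for i
    using that inj by (simp add: b_def the_inv_into_f_f)
  show thesis
  proof (rule that)
    show "card (Q ` {..<k}) = k"
      using inj by (simp add: card_image)
    fix n assume "n \<in> Q ` {..<k}"
    then obtain i where i: "i < k" "n = Q i"
      by blast
    show "n > 0"
      using q[OF i(1)] by (simp add: i Q_def)
    show "real n \<le> x"
      using q[OF i(1)] by (simp add: i Q_def)
    fix m assume "m \<in> Q ` {..<k}" "n \<noteq> m"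
    then obtain j where j: "j < k" "m = Q j"
      by blast
    have "i \<noteq> j"
      using i j \<open>n \<noteq> m\<close> by blast
    show "\<not> [b n = b m] (mod int (gcd n m))"
    proof
      assume "[b n = b m] (mod int (gcd n m))"
      then have "[a i = a j] (mod gcd (q i) (q j))"
        using i j by (simp add: b int_Q flip: gcd_int_int_eq)
      then obtain z where "z \<in> arith_prog (a i) (q i)" "z \<in> arith_prog (a j) (q j)"
        using ex_simultaneous_cong unfolding arith_prog_def by blast
      then show False
        using disjoint_family_onD[OF disj, of i j] i j \<open>i \<noteq> j\<close> by auto
    qed
  qed simp
qed

section \<open>Asymptotics for the two kinds of moduli\<close>

text \<open>With \<open>l = ln x\<close> and \<open>s = sqrt (l * ln l)\<close>, take
  \<open>j\<close> near \<open>l powr e\<close> in Rankin's bound. The power of \<open>j\<close>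
  gains \<open>exp (e/2 * s)\<close>, and \<open>(1 + l) ^ j\<close> is \<open>exp\<close> of o(s)
  when e < 1/2. Beating \<open>L (1/6) x\<close> needs e > 1/3; the choice is e = 2/5, giving 1/5 >
  1/6.\<close>

lemma eventually_few_with_many_prime_factors:
  "\<forall>\<^sub>F x in at_top. real (card {n. 1 \<le> n \<and> real n \<le> x \<and>
      nat \<lfloor>1/2 * sqrt (ln x / ln (ln x))\<rfloor> < card (prime_factors n)}) \<le> x / (2 * L (1/6) x)"
proof -
  have "\<forall>\<^sub>F l :: real in at_top. l \<ge> 2 \<and>
      (l powr (2/5) + 1) * ln (1 + l) + ln 2 + 1/6 * sqrt (l * ln l) \<le> 1/5 * sqrt (l * ln l)"
    by (intro eventually_conj eventually_ge_at_top) real_asymp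
  then have "\<forall>\<^sub>F x :: real in at_top. ln x \<ge> 2 \<and>
      (ln x powr (2/5) + 1) * ln (1 + ln x) + ln 2 + 1/6 * sqrt (ln x * ln (ln x))
        \<le> 1/5 * sqrt (ln x * ln (ln x))"
    by (rule eventually_compose_filterlim) (rule ln_at_top)
  then show ?thesis
    using eventually_ge_at_top[of 1]
  proof eventually_elim
    case (elim x)
    define l where "l = ln x"
    define s where "s = sqrt (l * ln l)"
    define \<kappa> where "\<kappa> = 1/2 * sqrt (l / ln l)"
    define K where "K = nat \<lfloor>\<kappa>\<rfloor>"
    define j where "j = nat \<lceil>l powr (2/5)\<rceil>"
    have l: "l \<ge> 2" and bound: "(l powr (2/5) + 1) * ln (1 + l) + ln 2 + 1/6 * s \<le> 1/5 * s"
      using elim by (simp_all add: l_def s_def)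
    have "ln l > 0"
      using l by simp
    have "\<kappa> \<ge> 0"
      using l \<open>ln l > 0\<close> by (simp add: \<kappa>_def)
    have j: "l powr (2/5) \<le> real j" "real j \<le> l powr (2/5) + 1"
      by (auto simp: j_def of_nat_ceiling le_of_int_ceiling of_int_ceiling_le_add_one)
    have "l powr (2/5) > 0"
      using l by simp
    \<comment> \<open>More than \<open>K\<close> prime factors means at least \<open>Suc K\<close>,
      so rounding \<kappa> down loses nothing.\<close>
    have "\<kappa> \<le> real (Suc K)"
      unfolding K_def by linarith
    have \<kappa>_s: "\<kappa> * ln l = 1/2 * s"
      using \<open>ln l > 0\<close> l by (simp add: \<kappa>_def s_def real_sqrt_divide real_sqrt_mult field_simps)
    have "2/5 * ln l = ln (l powr (2/5))"
      using l by (simp add: ln_powr)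
    also have "\<dots> \<le> ln (real j)"
      using j \<open>l powr (2/5) > 0\<close> by (subst ln_le_cancel_iff) linarith+
    finally have ln_j: "2/5 * ln l \<le> ln (real j)" .
    have "1/5 * s = \<kappa> * (2/5 * ln l)"
      using \<kappa>_s by simp
    also have "\<dots> \<le> real (Suc K) * ln (real j)"
      using \<open>\<kappa> \<ge> 0\<close> \<open>\<kappa> \<le> real (Suc K)\<close> ln_j \<open>ln l > 0\<close> by (intro mult_mono) auto
    finally have lower: "1/5 * s \<le> real (Suc K) * ln (real j)" .
    have "real j * ln (1 + l) \<le> (l powr (2/5) + 1) * ln (1 + l)"
      using j l by (intro mult_right_mono) auto
    with lower bound have "real j * ln (1 + l) + (ln 2 + 1/6 * s) \<le> real (Suc K) * ln (real j)"
      by linarith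
    then have "exp (real j * ln (1 + l) + (ln 2 + 1/6 * s)) \<le> exp (real (Suc K) * ln (real j))"
      by simp
    moreover have "real j > 0"
      using j \<open>l powr (2/5) > 0\<close> by linarith
    ultimately have "(1 + l) ^ j * (2 * L (1/6) x) \<le> real j ^ Suc K"
      using l by (simp only: exp_add exp_of_nat_mult exp_ln L_def flip: l_def s_def)
    then have "(1 + l) ^ j / real j ^ Suc K \<le> 1 / (2 * L (1/6) x)"
      using \<open>real j > 0\<close> by (simp add: field_simps L_def)
    then have "x * ((1 + l) ^ j / real j ^ Suc K) \<le> x * (1 / (2 * L (1/6) x))"
      using elim by (intro mult_left_mono) auto
    moreover have "real (card {n. 1 \<le> n \<and> real n \<le> x \<and> Suc K \<le> card (prime_factors n)})
        \<le> x * (1 + l) ^ j / real j ^ Suc K"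
      unfolding l_def using elim \<open>real j > 0\<close> by (intro card_many_prime_factors_le) auto
    ultimately show ?case
      by (simp add: K_def \<kappa>_def l_def Suc_le_eq)
  qed
qed

text \<open>Otherwise \<open>Y\<close> is at most \<open>2 * L (1/6) x * W ^ K\<close>, and
  \<open>card_moduli_le\<close> bounds \<open>card S\<close> by
  \<open>(2 * L (1/6) x * W ^ Suc K) ^ K\<close>. In logarithms the left side is l - o(l). On the
  right, W of order at most l^2 contributes l/2 and \<open>L (1/6) x\<close> contributes l/12, in
  total 7l/12 + o(l).\<close>

lemma eventually_few_with_few_prime_factors:
  "\<forall>\<^sub>F x in at_top. \<forall>a S.
     disjoint_progressions a S x
       (nat \<lfloor>1/2 * sqrt (ln x / ln (ln x))\<rfloor>) (nat \<lfloor>ln x / ln 2\<rfloor>)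
     \<longrightarrow> real (card S) < x / (2 * L (1/6) x)"
proof -
  have "\<forall>\<^sub>F l :: real in at_top. l \<ge> 2 \<and> 1 \<le> 1/2 * sqrt (l / ln l) \<and> 1/2 * sqrt (l / ln l) \<le> l \<and>
      1/2 * sqrt (l / ln l) * ((1/2 * sqrt (l / ln l) + 1) * ln (3 * l^2) + ln 2 + 1/6 * sqrt (l * ln l))
        < l - ln 2 - 1/6 * sqrt (l * ln l)"
    by (intro eventually_conj eventually_ge_at_top; real_asymp)
  then have "\<forall>\<^sub>F x :: real in at_top. ln x \<ge> 2 \<and> 1 \<le> 1/2 * sqrt (ln x / ln (ln x)) \<and>
      1/2 * sqrt (ln x / ln (ln x)) \<le> ln x \<and>
      1/2 * sqrt (ln x / ln (ln x)) *
        ((1/2 * sqrt (ln x / ln (ln x)) + 1) * ln (3 * (ln x)^2) + ln 2 + 1/6 * sqrt (ln x * ln (ln x)))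
        < ln x - ln 2 - 1/6 * sqrt (ln x * ln (ln x))"
    by (rule eventually_compose_filterlim) (rule ln_at_top)
  then show ?thesis
    using eventually_gt_at_top[of 0]
  proof eventually_elim
    case (elim x)
    define l where "l = ln x"
    define s where "s = sqrt (l * ln l)"
    define \<kappa> where "\<kappa> = 1/2 * sqrt (l / ln l)"
    define K where "K = nat \<lfloor>\<kappa>\<rfloor>"
    define J where "J = nat \<lfloor>l / ln 2\<rfloor>"
    have l: "l \<ge> 2" and \<kappa>: "1 \<le> \<kappa>" "\<kappa> \<le> l"
      and bound: "\<kappa> * ((\<kappa> + 1) * ln (3 * l^2) + ln 2 + 1/6 * s) < l - ln 2 - 1/6 * s"
      using elim by (simp_all add: l_def s_def \<kappa>_def)
    have K: "real K \<le> \<kappa>" "K \<ge> 1"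
      using \<kappa> by (auto simp: K_def le_nat_iff)
    have "1/2 < ln (2::real)"
      using ln2_ge_two_thirds by simp
    have "real J \<le> l / ln 2"
      using l by (simp add: J_def)
    also have "\<dots> \<le> l / (1/2)"
      using l \<open>1/2 < ln 2\<close> by (intro divide_left_mono) auto
    finally have J_le: "real J \<le> 2 * l" by simp
    have "1 \<le> l / ln 2"
      using l ln_2_less_1 by (simp add: field_simps)
    then have "J \<ge> 1"
      using le_nat_floor[of 1 "l / ln 2"] by (simp add: J_def)
    define W where "W = real (K * J)"
    have "1 * 1 \<le> K * J"
      using K \<open>J \<ge> 1\<close> by (intro mult_le_mono)
    then have KJ: "1 \<le> K * J" by simp
    then have W: "1 \<le> W"
      unfolding W_def by (metis of_nat_1 of_nat_mono)
    \<comment> \<open>Crude bounds suffice, as only \<open>ln W\<close> matters: \<open>K\<close> is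
      at most \<open>l\<close>, and \<open>J\<close> at most \<open>2 * l\<close> because
      \<open>ln 2 > 1/2\<close>.\<close>
    have "W \<le> l * (2 * l)"
      unfolding W_def of_nat_mult using K \<kappa> J_le l by (intro mult_mono) auto
    also have "\<dots> \<le> 3 * l^2"
      by (simp add: power2_eq_square)
    finally have ln_W: "ln W \<le> ln (3 * l^2)"
      using W l by (subst ln_le_cancel_iff) auto
    have "0 \<le> s"
      using l by (simp add: s_def)
    have x: "x > 0" "x = exp l"
      using elim by (simp_all add: l_def)
    have L: "L (1/6) x = exp (1/6 * s)"
      by (simp add: L_def s_def l_def)
    have "real (card S) < x / (2 * L (1/6) x)" if "disjoint_progressions a S x K J" for a S
    proof (rule ccontr)
      interpret disjoint_progressions a S x K J
        by fact
      assume "\<not> ?thesis"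
      then have large: "x / (2 * L (1/6) x) \<le> real (card S)"
        by simp
      have "card S > 0"
        using finite_S S_nonempty by (simp add: card_gt_0_iff)
      have "x \<le> real (card S) * (2 * L (1/6) x)"
        using large L by (simp add: field_simps)
      then have "x * W ^ K \<le> real (card S) * (2 * L (1/6) x) * W ^ K"
        using W by (intro mult_right_mono) auto
      then have "Y \<le> 2 * L (1/6) x * W ^ K"
        using \<open>card S > 0\<close> by (simp add: Y_def W_def field_simps)
      then have "Y * W \<le> 2 * L (1/6) x * W ^ Suc K"
        using W mult_right_mono[of Y _ W] by (simp add: mult_ac)
      have "exp (l - ln 2 - 1/6 * s) = x / (2 * L (1/6) x)"
        unfolding L exp_diff by (simp add: x(2))
      also have "\<dots> \<le> real (card S)"
        by (rule large)
      also have "\<dots> \<le> (Y * W) ^ K"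
        unfolding W_def using KJ by (rule card_moduli_le)
      also have "\<dots> \<le> (2 * L (1/6) x * W ^ Suc K) ^ K"
        using \<open>Y * W \<le> _\<close> x_nonneg W by (intro power_mono) (auto simp: Y_def)
      also have "\<dots> = exp (real K * (ln 2 + 1/6 * s + real (Suc K) * ln W))"
        using W by (simp only: exp_add exp_of_nat_mult exp_ln L)
      also have "\<dots> \<le> exp (\<kappa> * ((\<kappa> + 1) * ln (3 * l^2) + ln 2 + 1/6 * s))"
      proof -
        have "real (Suc K) * ln W \<le> (\<kappa> + 1) * ln (3 * l^2)"
          using K W ln_W \<kappa> by (intro mult_mono) auto
        then have "real K * (ln 2 + 1/6 * s + real (Suc K) * ln W) \<le> \<kappa> * ((\<kappa> + 1) * ln (3 * l^2) + ln 2 + 1/6 * s)"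
          using K \<kappa> W \<open>0 \<le> s\<close> by (intro mult_mono) auto
        then show ?thesis by simp
      qed
      finally show False
        using bound by simp
    qed
    then show ?case
      by (simp add: K_def J_def \<kappa>_def l_def)
  qed
qed

section \<open>Combining the two counts\<close>

text \<open>An optimal family is split by whether a modulus has more than \<open>K\<close> prime
  factors; each half is at most \<open>x / (2 * L (1/6) x)\<close>, the second strictly.\<close>

lemma eventually_f_less: "\<forall>\<^sub>F x in at_top. real (f x) < x / L (1/6) x"
  using eventually_few_with_many_prime_factors eventually_few_with_few_prime_factors
    eventually_gt_at_top[of 0]
proof eventually_elim
  case (elim x)
  define K where "K = nat \<lfloor>1/2 * sqrt (ln x / ln (ln x))\<rfloor>"
  define J where "J = nat \<lfloor>ln x / ln 2\<rfloor>"
  obtain a S where S: "finite S" "card S = f x" "\<And>q. q \<in> S \<Longrightarrow> q > 0" "\<And>q. q \<in> S \<Longrightarrow> real q \<le> x"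
    "\<And>q q'. q \<in> S \<Longrightarrow> q' \<in> S \<Longrightarrow> q \<noteq> q' \<Longrightarrow> \<not> [a q = a q'] (mod int (gcd q q'))"
    using admissible_imp_incongruent_moduli[OF admissible_f] by metis
  define B where "B = {n. 1 \<le> n \<and> real n \<le> x \<and> K < card (prime_factors n)}"
  define S' where "S' = {q \<in> S. card (prime_factors q) \<le> K}"
  have "B \<subseteq> {..nat \<lfloor>x\<rfloor>}"
    by (auto simp: B_def le_nat_floor)
  then have "finite B"
    by (rule finite_subset) simp
  have "S \<subseteq> S' \<union> B"
    using S(3,4) by (auto simp: S'_def B_def Suc_le_eq)
  have "finite S'"
    using S(1) by (simp add: S'_def)
  have "card S \<le> card (S' \<union> B)"
    using \<open>S \<subseteq> S' \<union> B\<close> \<open>finite S'\<close> \<open>finite B\<close> by (intro card_mono) auto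
  also have "\<dots> \<le> card S' + card B"
    by (rule card_Un_le)
  finally have "real (f x) \<le> real (card S') + real (card B)"
    using S(2) by simp
  moreover have "real (card B) \<le> x / (2 * L (1/6) x)"
    using elim(1) by (simp add: B_def K_def)
  moreover have "real (card S') < x / (2 * L (1/6) x)"
  \<comment> \<open>The locale assumes a nonempty family, so the empty one is treated apart.\<close>
  proof (cases "S' = {}")
    case True
    then show ?thesis
      using elim(3) by (simp add: L_def)
  next
    case False
    have "ln x / ln 2 < real (Suc J)"
      unfolding J_def by linarith
    then have "ln x < real (Suc J) * ln 2"
      by (simp add: pos_divide_less_eq)
    then have "exp (ln x) < exp (real (Suc J) * ln 2)"
      by simp
    also have "\<dots> = 2 ^ Suc J"
      by (simp only: exp_of_nat_mult exp_ln zero_less_numeral)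
    finally have "x < 2 ^ Suc J"
      using elim(3) by simp
    then have "disjoint_progressions a S' x K J"
      using False \<open>finite S'\<close> S(3,4,5) by unfold_locales (auto simp: S'_def)
    then show ?thesis
      using elim(2) by (simp add: K_def J_def)
  qed
  moreover have "x / (2 * L (1/6) x) + x / (2 * L (1/6) x) = x / L (1/6) x"
    by (simp add: field_simps L_def)
  ultimately show ?case
    by linarith
qed

theorem mainTheorem2:
  shows "\<exists>\<epsilon> :: real \<Rightarrow> real. (\<epsilon> \<longlongrightarrow> 0) at_top \<and>
           (\<forall>\<^sub>F x in at_top. real (f x) < x / L (1/6 - \<epsilon> x) x)"
  using eventually_f_less by (intro exI[of _ "\<lambda>_. 0"]) simp

end
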